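(* Let $R$ be a finite $\sigma$-elementary ring with unity, let $J$ be the Jacobson radical of $R$, and assume that $R/J$ is commutative. If $J \neq \{0\}$, then $\sigma(R) = p^d + 1$, where $p$ is the characteristic of $R$ and $d$ is a positive integer.
   Context: All rings are associative and unital, not necessarily commutative. A subring of a ring $R$ is a subset that is a group under addition and is closed under multiplication; it need not contain a multiplicative identity. A cover of $R$ is a collection of proper subrings of $R$ whose set-theoretic union equals $R$. If a cover exists, $R$ is coverable and $\sigma(R)$ denotes the cardinality of a minimal cover (a cover of least cardinality); if $R$ is not coverable, $\sigma(R) = \infty$, which is larger than every cardinal. A ring $R$ is $\sigma$-elementary if $R$ is coverable and $\sigma(R) < \sigma(R/I)$ for every nonzero two-sided ideal $I$ of $R$. *)

theory Defs
  imports "HOL-Algebra.Algebra" "HOL-Library.Extended_Nat"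
begin

text \<open>The library predicate \<^const>\<open>subring\<close> requires the subset to contain the identity of the
  ambient ring; the subrings used for covers need not contain any identity.\<close>

definition nonunital_subring :: "'a set \<Rightarrow> ('a, 'b) ring_scheme \<Rightarrow> bool" where
  "nonunital_subring S R \<longleftrightarrow>
     additive_subgroup S R \<and> (\<forall>x\<in>S. \<forall>y\<in>S. x \<otimes>\<^bsub>R\<^esub> y \<in> S)"

definition cover :: "('a, 'b) ring_scheme \<Rightarrow> 'a set set \<Rightarrow> bool" where
  "cover R C \<longleftrightarrow>
     (\<forall>S\<in>C. nonunital_subring S R \<and> S \<noteq> carrier R) \<and> \<Union>C = carrier R"

definition coverable :: "('a, 'b) ring_scheme \<Rightarrow> bool" where
  "coverable R \<longleftrightarrow> (\<exists>C. cover R C)"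

text \<open>The covering number. The infimum over the empty set is \<open>\<infinity>\<close>, so \<open>sigma R = \<infinity>\<close>
  if \<open>R\<close> is not coverable. As an element of \<^typ>\<open>enat\<close>, \<open>sigma R\<close> does not
  distinguish infinite cardinals from each other or from "not coverable". For a ring with finite
  carrier, and for its quotients, every cover is a finite set of finite sets, so in that case
  \<open>sigma\<close> is exactly the least cardinality of a cover, or \<open>\<infinity>\<close> if there is no cover. It is
  intended for such rings only.\<close>

definition sigma :: "('a, 'b) ring_scheme \<Rightarrow> enat" where
  "sigma R = (INF C \<in> {C. cover R C}. if finite C then enat (card C) else \<infinity>)"

definition sigma_elementary :: "('a, 'b) ring_scheme \<Rightarrow> bool" where
  "sigma_elementary R \<longleftrightarrow>
     coverable R \<and> (\<forall>I. ideal I R \<and> I \<noteq> {\<zero>\<^bsub>R\<^esub>} \<longrightarrow> sigma R < sigma (R Quot I))"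

definition left_ideal :: "'a set \<Rightarrow> ('a, 'b) ring_scheme \<Rightarrow> bool" where
  "left_ideal L R \<longleftrightarrow>
     additive_subgroup L R \<and> (\<forall>r\<in>carrier R. \<forall>x\<in>L. r \<otimes>\<^bsub>R\<^esub> x \<in> L)"

definition maximal_left_ideal :: "'a set \<Rightarrow> ('a, 'b) ring_scheme \<Rightarrow> bool" where
  "maximal_left_ideal M R \<longleftrightarrow>
     left_ideal M R \<and> M \<noteq> carrier R \<and>
     (\<forall>L. left_ideal L R \<and> M \<subseteq> L \<longrightarrow> L = M \<or> L = carrier R)"

text \<open>Intersecting with the carrier only matters if there is no maximal left ideal,
  that is, for the zero ring.\<close>

definition jacobson_radical :: "('a, 'b) ring_scheme \<Rightarrow> 'a set" where
  "jacobson_radical R = carrier R \<inter> \<Inter>{M. maximal_left_ideal M R}"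

text \<open>The least positive \<open>n\<close> with \<open>n\<cdot>1 = 0\<close>, and \<open>0\<close> if there is none.\<close>

definition characteristic :: "('a, 'b) ring_scheme \<Rightarrow> nat" where
  "characteristic R =
     (if \<exists>n::nat. n > 0 \<and> [n] \<cdot>\<^bsub>R\<^esub> \<one>\<^bsub>R\<^esub> = \<zero>\<^bsub>R\<^esub>
      then LEAST n::nat. n > 0 \<and> [n] \<cdot>\<^bsub>R\<^esub> \<one>\<^bsub>R\<^esub> = \<zero>\<^bsub>R\<^esub>
      else 0)"

end

theory Submission
  imports Defs
begin

text \<open>
  Let \<open>N\<close> be a minimal ideal of \<open>R\<close> inside \<open>J\<close>. Then \<open>JN = NJ = 0\<close>, so, \<open>R/J\<close> being
  commutative, all left and right
  multiplications on \<open>N\<close> commute with each other. A subring \<open>S \<noteq> R\<close> with \<open>S + N = R\<close> meets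
  \<open>N\<close> in an ideal, hence in \<open>0\<close>: it is a complement of \<open>N\<close>, and as such the kernel of a
  derivation \<open>R \<rightarrow> N\<close> that is the identity on \<open>N\<close>.

  Lower bound: since \<open>\<sigma>(R/N) > \<sigma>(R)\<close>, the members of a least cover that are not complements
  miss a coset of \<open>N\<close>. Each complement contains one element of that coset, so there are at least
  \<open>|N|\<close> complements; they do not cover \<open>N\<close>, hence \<open>\<sigma>(R) \<ge> |N| + 1\<close>.

  Upper bound: two complements give derivations \<open>\<rho>\<close> and \<open>\<rho>'\<close>; put \<open>D = \<rho> - \<rho>'\<close>. The
  nonzero bimodule endomorphisms \<open>f\<close> of \<open>N\<close> act simply transitively on the nonzero elements of
  \<open>N\<close>, so the kernels of \<open>\<rho> - f \<circ> D\<close>, with \<open>|N|\<close> choices of \<open>f\<close> (zero included), cover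
  everything outside the kernel of \<open>D\<close>.

  A prime \<open>p\<close> with \<open>pN = 0\<close> satisfies \<open>pR = 0\<close>, because \<open>pR\<close> is killed by every
  derivation into \<open>N\<close> and so lies in all members of this least cover.
\<close>

section \<open>Finite groups of prime exponent\<close>

text \<open>A prime \<open>q\<close> dividing the order gives a subgroup of order \<open>q\<close>.
  A nontrivial element of it has order dividing both \<open>q\<close> and \<open>p\<close>, so
  \<open>q = p\<close>.\<close>

lemma (in group) order_eq_prime_power:
  assumes fin: "finite (carrier G)" and p: "normalization_semidom_class.prime p"
    and exponent: "\<And>x. x \<in> carrier G \<Longrightarrow> x [^] p = \<one>"
  obtains k where "order G = p ^ k"
proof -
  have q_eq: "q = p" if q: "normalization_semidom_class.prime q" "q dvd order G" for q
  proof -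
    \<comment> \<open>The cofactor \<open>m\<close> may still be divisible by \<open>q\<close>:
      Sylow's theorem is used for a subgroup of order exactly \<open>q\<close>, not for a full Sylow
      subgroup.\<close>
    obtain m where "order G = q ^ 1 * m"
      using q by (auto elim: dvdE)
    then obtain H where H: "subgroup H G" "card H = q ^ 1"
      using sylow_thm[OF q(1) is_group _ fin] by blast
    interpret H: subgroup H G by (rule H(1))
    have "\<not> H \<subseteq> {\<one>}"
      using H(2) prime_gt_1_nat[OF q(1)] card_mono[of "{\<one>}" H] by auto
    then obtain x where x: "x \<in> H" "x \<noteq> \<one>" by blast
    have xc: "x \<in> carrier G" using x H.subset by blast
    have "x [^] q = \<one>"
    proof -
      interpret HG: group "G\<lparr>carrier := H\<rparr>" by (rule H.subgroup_is_group) (rule is_group)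
      have "x [^]\<^bsub>G\<lparr>carrier := H\<rparr>\<^esub> order (G\<lparr>carrier := H\<rparr>) = \<one>\<^bsub>G\<lparr>carrier := H\<rparr>\<^esub>"
        using x by (intro HG.pow_order_eq_1) simp
      then show ?thesis
        using H(2) by (simp add: order_def nat_pow_consistent[symmetric])
    qed
    then have "ord x dvd q" "ord x dvd p"
      using exponent[OF xc] xc by (simp_all add: pow_eq_id)
    moreover have "ord x \<noteq> 1"
      using ord_eq_1[OF xc] x(2) by blast
    ultimately show ?thesis
      using q(1) p by (metis prime_nat_iff)
  qed
  have pos: "order G \<noteq> 0"
    using order_gt_0_iff_finite fin by simp
  obtain b where b: "order G = p ^ multiplicity p (order G) * b" "\<not> p dvd b"
    using multiplicity_decompose'[OF pos] p not_prime_unit by blast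
  have "b = 1"
  proof (rule ccontr)
    assume "b \<noteq> 1"
    then obtain q where "normalization_semidom_class.prime q" "q dvd b"
      using prime_factor_nat by blast
    then show False
      using q_eq[of q] b by (metis dvd_mult)
  qed
  then show ?thesis
    using that b by simp
qed

section \<open>Covers and quotients\<close>

lemma sigma_le_card:
  assumes "cover R C" "finite C"
  shows "sigma R \<le> enat (card C)"
  unfolding sigma_def by (rule INF_lower2[of C]) (simp_all add: assms)

text \<open>Covers of a finite carrier are finite families, so the infimum is the cardinality of an
  actual cover.\<close>

lemma sigma_attained:
  assumes "coverable R" "finite (carrier R)"
  obtains C where "cover R C" "finite C" "sigma R = enat (card C)"
proof -
  let ?A = "(\<lambda>C. if finite C then enat (card C) else \<infinity>) ` {C. cover R C}"
  have fin: "finite C" if "cover R C" for C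
  proof -
    have "C \<subseteq> Pow (carrier R)"
      using that unfolding cover_def by blast
    then show ?thesis
      using assms(2) by (simp add: finite_subset)
  qed
  have "?A \<noteq> {}"
    using assms(1) unfolding coverable_def by blast
  \<comment> \<open>On a nonempty set of \<open>enat\<close> values, \<open>Inf\<close> is a
    \<open>LEAST\<close> and hence attained.\<close>
  then have "Inf ?A \<in> ?A"
    unfolding Inf_enat_def by (simp only: if_False) (rule LeastI_ex, blast)
  then obtain C where "cover R C" "sigma R = (if finite C then enat (card C) else \<infinity>)"
    unfolding sigma_def by blast
  then show ?thesis
    using fin[of C] that[of C] by simp
qed

context ring
begin

lemma additive_subgroupI_closed:
  assumes "H \<subseteq> carrier R" "\<zero> \<in> H"
    and "\<And>x y. \<lbrakk>x \<in> H; y \<in> H\<rbrakk> \<Longrightarrow> x \<oplus> y \<in> H"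
    and "\<And>x. x \<in> H \<Longrightarrow> \<ominus> x \<in> H"
  shows "additive_subgroup H R"
proof (rule additive_subgroupI, rule add.subgroupI)
  show "H \<noteq> {}" using assms(2) by blast
qed (rule assms; assumption)+

text \<open>Negatives are multiples by \<open>\<ominus> \<one>\<close>, so the criteria for ideals
  below ask only for zero, sums and multiples.\<close>

lemma minus_closed_of_left_mult:
  assumes "H \<subseteq> carrier R" "\<And>r x. \<lbrakk>r \<in> carrier R; x \<in> H\<rbrakk> \<Longrightarrow> r \<otimes> x \<in> H" "x \<in> H"
  shows "\<ominus> x \<in> H"
proof -
  have "\<ominus> x = (\<ominus> \<one>) \<otimes> x"
    using assms(1,3) by (simp add: l_minus subset_iff)
  then show ?thesis
    using assms(2)[OF _ assms(3), of "\<ominus> \<one>"] by simp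
qed

lemma left_idealI:
  assumes "H \<subseteq> carrier R" "\<zero> \<in> H"
    and "\<And>x y. \<lbrakk>x \<in> H; y \<in> H\<rbrakk> \<Longrightarrow> x \<oplus> y \<in> H"
    and "\<And>r x. \<lbrakk>r \<in> carrier R; x \<in> H\<rbrakk> \<Longrightarrow> r \<otimes> x \<in> H"
  shows "left_ideal H R"
  unfolding left_ideal_def
proof (intro conjI ballI)
  show "additive_subgroup H R"
    by (rule additive_subgroupI_closed)
      (rule assms minus_closed_of_left_mult[OF assms(1,4)]; assumption)+
qed (rule assms)

lemma idealI_closed:
  assumes "H \<subseteq> carrier R" "\<zero> \<in> H"
    and "\<And>x y. \<lbrakk>x \<in> H; y \<in> H\<rbrakk> \<Longrightarrow> x \<oplus> y \<in> H"
    and "\<And>r x. \<lbrakk>r \<in> carrier R; x \<in> H\<rbrakk> \<Longrightarrow> r \<otimes> x \<in> H"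
    and "\<And>r x. \<lbrakk>r \<in> carrier R; x \<in> H\<rbrakk> \<Longrightarrow> x \<otimes> r \<in> H"
  shows "ideal H R"
proof (rule idealI[OF ring_axioms])
  show "subgroup H (add_monoid R)"
    by (rule additive_subgroup.a_subgroup, rule additive_subgroupI_closed)
      (rule assms minus_closed_of_left_mult[OF assms(1,4)]; assumption)+
qed (rule assms; assumption)+

text \<open>\<open>S <+> I\<close> is the preimage of the image of \<open>S\<close> in the quotient,
  so properness and covering of the images can be tested inside \<open>R\<close>. Different members
  may have the same image, so the family of images can be smaller than \<open>C\<close>.\<close>

lemma sigma_quotient_le_card:
  assumes I: "ideal I R" and "finite C"
    and sub: "\<And>S. S \<in> C \<Longrightarrow> nonunital_subring S R"
    and proper: "\<And>S. S \<in> C \<Longrightarrow> S <+>\<^bsub>R\<^esub> I \<noteq> carrier R"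
    and union: "carrier R \<subseteq> (\<Union>S\<in>C. S <+>\<^bsub>R\<^esub> I)"
  shows "sigma (R Quot I) \<le> enat (card C)"
proof -
  interpret I: ideal I R by (rule I)
  interpret h: ring_hom_ring R "R Quot I" "(+>) I" by (rule I.rcos_ring_hom_ring)
  have carrier_Quot: "carrier (R Quot I) = (+>) I ` carrier R"
    unfolding FactRing_def A_RCOSETS_def' by (simp add: UNION_singleton_eq_range)
  have Scarr: "S \<subseteq> carrier R" if "S \<in> C" for S
    using sub[OF that] additive_subgroup.a_subset[of S R] by (simp add: nonunital_subring_def)
  have mem_sum: "r \<in> S <+>\<^bsub>R\<^esub> I" if "S \<in> C" "r \<in> carrier R" "s \<in> S" "I +> r = I +> s" for r s S
  proof -
    have s: "s \<in> carrier R" using Scarr that by blast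
    have "r \<in> I +> s"
      using I.a_rcos_self[OF that(2)] that(4) by simp
    then obtain i where "i \<in> I" "r = i \<oplus> s"
      by (auto simp: a_r_coset_def')
    then have "r = s \<oplus> i"
      using s I.Icarr a_comm by metis
    then show ?thesis
      using that(3) \<open>i \<in> I\<close> unfolding set_add_def' by blast
  qed
  define C' where "C' = (\<lambda>S. (+>) I ` S) ` C"
  have "cover (R Quot I) C'"
    unfolding cover_def
  proof (intro conjI ballI)
    fix T assume "T \<in> C'"
    then obtain S where S: "S \<in> C" "T = (+>) I ` S"
      unfolding C'_def by blast
    have "subgroup T (add_monoid (R Quot I))"
      unfolding S(2)
      by (rule group_hom.subgroup_img_is_subgroup[OF h.a_group_hom])
        (use sub[OF S(1)] in \<open>auto simp: nonunital_subring_def additive_subgroup_def\<close>)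
    moreover have "x \<otimes>\<^bsub>R Quot I\<^esub> y \<in> T" if "x \<in> T" "y \<in> T" for x y
    proof -
      obtain a b where ab: "a \<in> S" "b \<in> S" "x = I +> a" "y = I +> b"
        using \<open>x \<in> T\<close> \<open>y \<in> T\<close> S(2) by blast
      then have "x \<otimes>\<^bsub>R Quot I\<^esub> y = I +> (a \<otimes> b)"
        using Scarr[OF S(1)] by (simp add: subset_iff)
      moreover have "a \<otimes> b \<in> S"
        using sub[OF S(1)] ab unfolding nonunital_subring_def by blast
      ultimately show ?thesis
        unfolding S(2) by (rule image_eqI)
    qed
    ultimately show "nonunital_subring T (R Quot I)"
      by (simp add: nonunital_subring_def additive_subgroup_def)
    show "T \<noteq> carrier (R Quot I)"
    proof
      assume "T = carrier (R Quot I)"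
      have "carrier R \<subseteq> S <+>\<^bsub>R\<^esub> I"
      proof
        fix r assume r: "r \<in> carrier R"
        then have "I +> r \<in> T"
          using carrier_Quot \<open>T = carrier (R Quot I)\<close> by blast
        then show "r \<in> S <+>\<^bsub>R\<^esub> I"
          using mem_sum[OF S(1) r] S(2) by blast
      qed
      moreover have "S <+>\<^bsub>R\<^esub> I \<subseteq> carrier R"
        using Scarr[OF S(1)] I.a_subset by (rule set_add_closed)
      ultimately show False
        using proper[OF S(1)] by blast
    qed
  next
    show "\<Union>C' = carrier (R Quot I)"
    proof
      show "\<Union>C' \<subseteq> carrier (R Quot I)"
        using Scarr unfolding C'_def carrier_Quot by blast
      show "carrier (R Quot I) \<subseteq> \<Union>C'"
      proof
        fix Y assume "Y \<in> carrier (R Quot I)"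
        then obtain r where r: "r \<in> carrier R" "Y = I +> r"
          using carrier_Quot by blast
        then obtain S s i where S: "S \<in> C" "s \<in> S" "i \<in> I" "r = s \<oplus> i"
          using union unfolding set_add_def' by blast
        have s: "s \<in> carrier R" using Scarr S by blast
        have "r = i \<oplus> s"
          using S(3,4) s I.Icarr a_comm by metis
        then have "r \<in> I +> s"
          using S(3) by (auto simp: a_r_coset_def')
        then have "Y = I +> s"
          using I.a_repr_independence' s r(2) by metis
        then have "Y \<in> (+>) I ` S"
          using S(2) by (rule image_eqI)
        then show "Y \<in> \<Union>C'"
          using S(1) unfolding C'_def by blast
      qed
    qed
  qed
  moreover have "finite C'" "card C' \<le> card C"
    using \<open>finite C\<close> unfolding C'_def by (auto intro: card_image_le)
  ultimately show ?thesis
    using sigma_le_card[of "R Quot I" C'] order_trans[of _ "enat (card C')" "enat (card C)"] by simp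
qed

section \<open>The Jacobson radical of a finite ring\<close>

text \<open>Finiteness takes the place of Zorn's lemma.\<close>

lemma maximal_left_ideal_exists:
  assumes "finite (carrier R)" "left_ideal L R" "L \<noteq> carrier R"
  obtains M where "maximal_left_ideal M R" "L \<subseteq> M"
proof -
  let ?P = "\<lambda>K. left_ideal K R \<and> K \<noteq> carrier R \<and> L \<subseteq> K"
  have "{K. ?P K} \<subseteq> Pow (carrier R)"
    using additive_subgroup.a_subset[of _ R] by (auto simp: left_ideal_def)
  then have "finite {K. ?P K}"
    using assms(1) by (simp add: finite_subset)
  moreover have "L \<in> {K. ?P K}"
    using assms by simp
  ultimately have "\<exists>M\<in>{K. ?P K}. L \<subseteq> M \<and> (\<forall>K\<in>{K. ?P K}. M \<subseteq> K \<longrightarrow> M = K)"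
    by (rule finite_has_maximal2)
  then obtain M where "M \<in> {K. ?P K}" "\<forall>K\<in>{K. ?P K}. M \<subseteq> K \<longrightarrow> M = K"
    by (elim bexE conjE) (rule that)
  then have M: "?P M" and max: "\<And>K. \<lbrakk>?P K; M \<subseteq> K\<rbrakk> \<Longrightarrow> M = K"
    by simp_all
  have "L' = M \<or> L' = carrier R" if "left_ideal L' R" "M \<subseteq> L'" for L'
    using max[of L'] M that by auto
  then have "maximal_left_ideal M R"
    unfolding maximal_left_ideal_def using M by simp
  then show ?thesis
    using that[of M] M by simp
qed

text \<open>The set is \<open>M + Rx\<close>. It serves both as a principal left ideal, with
  \<open>M = {\<zero>}\<close>, and as an enlargement of a maximal left ideal.\<close>

lemma left_ideal_add_principal:
  assumes M: "left_ideal M R" and x: "x \<in> carrier R"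
  shows "left_ideal {m \<oplus> r \<otimes> x |m r. m \<in> M \<and> r \<in> carrier R} R" (is "left_ideal ?L R")
proof (rule left_idealI)
  interpret M: additive_subgroup M R using M unfolding left_ideal_def by blast
  have carr: "m \<in> carrier R" if "m \<in> M" for m using that M.a_subset by blast
  show "?L \<subseteq> carrier R" using carr x by auto
  have "\<zero> = \<zero> \<oplus> \<zero> \<otimes> x" using x by simp
  then show "\<zero> \<in> ?L" using M.zero_closed by blast
  fix a assume "a \<in> ?L"
  then obtain m r where a: "m \<in> M" "r \<in> carrier R" "a = m \<oplus> r \<otimes> x" by blast
  show "a \<oplus> b \<in> ?L" if "b \<in> ?L" for b
  proof -
    obtain m' r' where b: "m' \<in> M" "r' \<in> carrier R" "b = m' \<oplus> r' \<otimes> x"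
      using \<open>b \<in> ?L\<close> by blast
    have "a \<oplus> b = (m \<oplus> m') \<oplus> (r \<oplus> r') \<otimes> x"
      using a b x carr by (simp add: l_distr a_ac)
    then show ?thesis using M.a_closed[OF a(1) b(1)] a_closed[OF a(2) b(2)] by blast
  qed
  show "s \<otimes> a \<in> ?L" if "s \<in> carrier R" for s
  proof -
    have "s \<otimes> a = s \<otimes> m \<oplus> (s \<otimes> r) \<otimes> x"
      using a x carr that by (simp add: r_distr m_assoc)
    moreover have "s \<otimes> m \<in> M"
      using M that a unfolding left_ideal_def by blast
    ultimately show ?thesis using m_closed[OF that a(2)] by blast
  qed
qed

lemma jacobson_radicalD: "\<lbrakk>x \<in> jacobson_radical R; maximal_left_ideal M R\<rbrakk> \<Longrightarrow> x \<in> M"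
  by (simp add: jacobson_radical_def)

lemma jacobson_radical_carrier: "x \<in> jacobson_radical R \<Longrightarrow> x \<in> carrier R"
  by (simp add: jacobson_radical_def)

lemma jacobson_radical_left_mult:
  assumes "x \<in> jacobson_radical R" "r \<in> carrier R"
  shows "r \<otimes> x \<in> jacobson_radical R"
  using assms by (auto simp: jacobson_radical_def maximal_left_ideal_def left_ideal_def)

text \<open>If \<open>\<one> \<ominus> j\<close> did not generate \<open>R\<close> as a left ideal,
  it would lie in a maximal left ideal. That ideal also contains \<open>j\<close>, hence
  \<open>\<one>\<close>.\<close>

lemma left_inverse_one_minus_jacobson:
  assumes fin: "finite (carrier R)" and j: "j \<in> jacobson_radical R"
  obtains u where "u \<in> carrier R" "u \<otimes> (\<one> \<ominus> j) = \<one>"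
proof -
  have jc: "j \<in> carrier R" using j by (rule jacobson_radical_carrier)
  define L where "L = {m \<oplus> r \<otimes> (\<one> \<ominus> j) |m r. m \<in> {\<zero>} \<and> r \<in> carrier R}"
  have L: "left_ideal L R"
    unfolding L_def using jc by (intro left_ideal_add_principal left_idealI) auto
  have "\<one> \<ominus> j = \<zero> \<oplus> \<one> \<otimes> (\<one> \<ominus> j)"
    using jc by simp
  then have "\<one> \<ominus> j \<in> L"
    unfolding L_def by blast
  have "L = carrier R"
  proof (rule ccontr)
    assume "L \<noteq> carrier R"
    then obtain M where M: "maximal_left_ideal M R" "L \<subseteq> M"
      using maximal_left_ideal_exists[OF fin L] by blast
    interpret M: additive_subgroup M R
      using M(1) unfolding maximal_left_ideal_def left_ideal_def by blast
    have "(\<one> \<ominus> j) \<oplus> j \<in> M"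
      using M \<open>\<one> \<ominus> j \<in> L\<close> jacobson_radicalD[OF j] by (blast intro: M.a_closed)
    then have "\<one> \<in> M"
      using jc by (simp add: minus_eq a_assoc l_neg)
    then have "r \<in> M" if "r \<in> carrier R" for r
      using M(1) that unfolding maximal_left_ideal_def left_ideal_def by (metis r_one)
    then have "M = carrier R"
      using M.a_subset by blast
    then show False
      using M(1) unfolding maximal_left_ideal_def by blast
  qed
  then have "\<one> \<in> L" by simp
  then obtain u where "u \<in> carrier R" "\<one> = u \<otimes> (\<one> \<ominus> j)"
    unfolding L_def using jc by auto
  then show ?thesis using that by simp
qed

text \<open>Left multiplication by \<open>a\<close> is injective, hence surjective on a finite
  carrier, and so reaches \<open>\<one>\<close>.\<close>

lemma left_inverse_imp_right_inverse:
  assumes "finite (carrier R)" "a \<in> carrier R" "u \<in> carrier R" "u \<otimes> a = \<one>"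
  shows "a \<otimes> u = \<one>"
proof -
  have "inj_on ((\<otimes>) a) (carrier R)"
    by (rule inj_on_inverseI[of _ "(\<otimes>) u"]) (use assms(2-4) in \<open>simp flip: m_assoc\<close>)
  then have "(\<otimes>) a ` carrier R = carrier R"
    using assms by (intro endo_inj_surj) auto
  then obtain v where v: "v \<in> carrier R" "a \<otimes> v = \<one>"
    by (metis imageE one_closed)
  have "u = u \<otimes> (a \<otimes> v)"
    using v assms(3) by simp
  also have "\<dots> = v"
    using v(1) assms(2-4) by (simp flip: m_assoc)
  finally show ?thesis using v(2) by simp
qed

text \<open>A one-element form of Nakayama's lemma: \<open>\<one> \<ominus> j\<close> kills
  \<open>x\<close> and has a left inverse.\<close>

lemma fixed_by_jacobson_left:
  assumes "finite (carrier R)" "j \<in> jacobson_radical R" "x \<in> carrier R" "x = j \<otimes> x"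
  shows "x = \<zero>"
proof -
  obtain u where u: "u \<in> carrier R" "u \<otimes> (\<one> \<ominus> j) = \<one>"
    using left_inverse_one_minus_jacobson assms by blast
  have j: "j \<in> carrier R" using assms(2) by (rule jacobson_radical_carrier)
  have "x = u \<otimes> ((\<one> \<ominus> j) \<otimes> x)"
    using u j assms(3) by (simp flip: m_assoc)
  also have "(\<one> \<ominus> j) \<otimes> x = x \<ominus> j \<otimes> x"
    using j assms(3) by (simp add: minus_eq l_distr l_minus)
  also have "\<dots> = \<zero>"
    using assms(3,4) by (metis r_right_minus_eq)
  finally show ?thesis using u by simp
qed

text \<open>Cancelling on the right takes a right inverse of \<open>\<one> \<ominus> j\<close>,
  which finiteness supplies.\<close>

lemma fixed_by_jacobson_right:
  assumes "finite (carrier R)" "j \<in> jacobson_radical R" "x \<in> carrier R" "x = x \<otimes> j"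
  shows "x = \<zero>"
proof -
  obtain u where u: "u \<in> carrier R" "u \<otimes> (\<one> \<ominus> j) = \<one>"
    using left_inverse_one_minus_jacobson assms by blast
  have j: "j \<in> carrier R" using assms(2) by (rule jacobson_radical_carrier)
  have "(\<one> \<ominus> j) \<otimes> u = \<one>"
    using left_inverse_imp_right_inverse[OF assms(1) _ u] j by simp
  then have "x = (x \<otimes> (\<one> \<ominus> j)) \<otimes> u"
    using u j assms(3) by (simp add: m_assoc)
  also have "x \<otimes> (\<one> \<ominus> j) = x \<ominus> x \<otimes> j"
    using j assms(3) by (simp add: minus_eq r_distr r_minus)
  also have "\<dots> = \<zero>"
    using assms(3,4) by (metis r_right_minus_eq)
  finally show ?thesis using u by simp
qed

text \<open>If a maximal \<open>M\<close> misses \<open>x \<otimes> r\<close>, then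
  \<open>M + R(xr) = R\<close>, so \<open>r = m + s(xr)\<close> with \<open>m\<close> in
  \<open>M\<close>. Thus \<open>(1 - sx)r = m\<close>, and since \<open>1 - sx\<close> has a left
  inverse, \<open>r\<close> and then \<open>x \<otimes> r\<close> lie in \<open>M\<close> after
  all.\<close>

lemma jacobson_radical_right_mult:
  assumes fin: "finite (carrier R)" and x: "x \<in> jacobson_radical R" and r: "r \<in> carrier R"
  shows "x \<otimes> r \<in> jacobson_radical R"
proof -
  have xc: "x \<in> carrier R" using x by (rule jacobson_radical_carrier)
  have "x \<otimes> r \<in> M" if M: "maximal_left_ideal M R" for M
  proof (rule ccontr)
    assume notin: "x \<otimes> r \<notin> M"
    have lid: "left_ideal M R" using M unfolding maximal_left_ideal_def by blast
    interpret M: additive_subgroup M R using lid unfolding left_ideal_def by blast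
    define L where "L = {m \<oplus> s \<otimes> (x \<otimes> r) |m s. m \<in> M \<and> s \<in> carrier R}"
    have "left_ideal L R"
      unfolding L_def using lid xc r by (intro left_ideal_add_principal) auto
    moreover have "m \<oplus> \<zero> \<otimes> (x \<otimes> r) \<in> L" if "m \<in> M" for m
      using that unfolding L_def by blast
    then have "M \<subseteq> L"
      using M.a_subset xc r by force
    moreover have "\<zero> \<oplus> \<one> \<otimes> (x \<otimes> r) \<in> L"
      using M.zero_closed unfolding L_def by blast
    then have "L \<noteq> M"
      using notin xc r by auto
    ultimately have "L = carrier R"
      using M unfolding maximal_left_ideal_def by blast
    then obtain m s where ms: "m \<in> M" "s \<in> carrier R" "r = m \<oplus> s \<otimes> (x \<otimes> r)"
      using r unfolding L_def by blast
    have m: "m \<in> carrier R" using ms M.a_subset by blast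
    have sx: "s \<otimes> x \<in> jacobson_radical R"
      using x ms by (simp add: jacobson_radical_left_mult)
    obtain u where u: "u \<in> carrier R" "u \<otimes> (\<one> \<ominus> s \<otimes> x) = \<one>"
      using left_inverse_one_minus_jacobson[OF fin sx] by blast
    have "(\<one> \<ominus> s \<otimes> x) \<otimes> r = r \<ominus> s \<otimes> (x \<otimes> r)"
      using ms xc r by (simp add: minus_eq l_distr l_minus m_assoc)
    also have "\<dots> = m"
      using ms(3) m ms(2) xc r by (metis a_closed add.inv_solve_right m_closed minus_eq)
    finally have "u \<otimes> m = r"
      using u ms xc r m by (metis l_one m_assoc m_closed minus_closed one_closed)
    then have "r \<in> M"
      using lid u ms unfolding left_ideal_def by blast
    then show False
      using notin lid xc unfolding left_ideal_def by blast
  qed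
  then show ?thesis
    using xc r by (simp add: jacobson_radical_def)
qed

lemma ideal_jacobson_radical:
  assumes "finite (carrier R)"
  shows "ideal (jacobson_radical R) R"
proof (rule idealI_closed)
  have add: "additive_subgroup M R" if "maximal_left_ideal M R" for M
    using that by (auto simp: maximal_left_ideal_def left_ideal_def)
  show "\<zero> \<in> jacobson_radical R"
    using additive_subgroup.zero_closed[OF add] by (auto simp: jacobson_radical_def)
  show "x \<oplus> y \<in> jacobson_radical R"
    if "x \<in> jacobson_radical R" "y \<in> jacobson_radical R" for x y
    using that additive_subgroup.a_closed[OF add] by (auto simp: jacobson_radical_def)
qed (auto simp: jacobson_radical_carrier jacobson_radical_left_mult
       jacobson_radical_right_mult[OF assms])

section \<open>Minimal ideals inside the radical\<close>

lemma minimal_ideal_exists: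
  assumes "finite (carrier R)" "ideal J R" "J \<noteq> {\<zero>}"
  obtains N where "ideal N R" "N \<subseteq> J" "N \<noteq> {\<zero>}"
    "\<And>I. \<lbrakk>ideal I R; I \<subseteq> N\<rbrakk> \<Longrightarrow> I = {\<zero>} \<or> I = N"
proof -
  let ?A = "{I. ideal I R \<and> I \<noteq> {\<zero>}}"
  have "?A \<subseteq> Pow (carrier R)"
    using ideal.Icarr[of _ R] by blast
  then have "finite ?A"
    using assms(1) by (simp add: finite_subset)
  moreover have "J \<in> ?A"
    using assms by simp
  ultimately have "\<exists>N\<in>?A. N \<subseteq> J \<and> (\<forall>I\<in>?A. I \<subseteq> N \<longrightarrow> N = I)"
    by (rule finite_has_minimal2)
  then obtain N where "N \<in> ?A" "N \<subseteq> J" "\<forall>I\<in>?A. I \<subseteq> N \<longrightarrow> N = I"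
    by (elim bexE conjE) (rule that)
  then show ?thesis
    using that[of N] by auto
qed

text \<open>The elements of \<open>N\<close> killed by the radical from one side form a two-sided
  ideal. Once it is known to be nonzero, minimality makes it all of \<open>N\<close>.\<close>

lemma jacobson_annihilates_minimal_ideal:
  assumes fin: "finite (carrier R)" and N: "ideal N R" "N \<subseteq> jacobson_radical R" "N \<noteq> {\<zero>}"
    and min: "\<And>I. \<lbrakk>ideal I R; I \<subseteq> N\<rbrakk> \<Longrightarrow> I = {\<zero>} \<or> I = N"
    and j: "j \<in> jacobson_radical R" and n: "n \<in> N"
  shows "j \<otimes> n = \<zero>" "n \<otimes> j = \<zero>"
proof -
  interpret N: ideal N R by (rule N(1))
  interpret J: ideal "jacobson_radical R" R by (rule ideal_jacobson_radical[OF fin])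
  let ?J = "jacobson_radical R"
  note carr = N.Icarr J.Icarr
  have "finite ?J"
    using fin J.a_subset by (rule rev_finite_subset)
  obtain x0 where x0: "x0 \<in> N - {\<zero>}"
    using N(3) N.zero_closed by blast
  txt \<open>Nonzero elements of \<open>N\<close> for which \<open>J x\<close>, respectively \<open>x J\<close>, is as small as possible
    are annihilated by \<open>J\<close>.\<close>
  obtain x where x: "x \<in> N - {\<zero>}"
    and x_min: "\<And>y. y \<in> N - {\<zero>} \<Longrightarrow> card ((\<lambda>j. j \<otimes> x) ` ?J) \<le> card ((\<lambda>j. j \<otimes> y) ` ?J)"
    using ex_has_least_nat[of "\<lambda>x. x \<in> N - {\<zero>}" x0 "\<lambda>x. card ((\<lambda>j. j \<otimes> x) ` ?J)"] x0 by blast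
  have Jx: "j \<otimes> x = \<zero>" if j: "j \<in> ?J" for j
  proof (rule ccontr)
    assume nz: "j \<otimes> x \<noteq> \<zero>"
    have "(\<lambda>i. i \<otimes> (j \<otimes> x)) ` ?J \<subseteq> (\<lambda>i. i \<otimes> x) ` ?J"
    proof (rule image_subsetI)
      fix i assume i: "i \<in> ?J"
      have "i \<otimes> (j \<otimes> x) = (i \<otimes> j) \<otimes> x"
        using i j x by (simp add: carr m_assoc)
      then show "i \<otimes> (j \<otimes> x) \<in> (\<lambda>i. i \<otimes> x) ` ?J"
        using J.I_l_closed[OF j J.Icarr[OF i]] by blast
    qed
    moreover have "j \<otimes> x \<in> N - {\<zero>}"
      using nz x j by (simp add: N.I_l_closed carr)
    \<comment> \<open>Inclusion and the minimal choice of \<open>x\<close> force equality. Since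
      \<open>j \<otimes> x\<close> lies in the right-hand set, some \<open>i\<close> in the radical
      fixes it, so it vanishes.\<close>
    ultimately have "(\<lambda>i. i \<otimes> (j \<otimes> x)) ` ?J = (\<lambda>i. i \<otimes> x) ` ?J"
      using x_min \<open>finite ?J\<close> by (intro card_seteq) auto
    then obtain i where "i \<in> ?J" "j \<otimes> x = i \<otimes> (j \<otimes> x)"
      using j by (metis (no_types, lifting) imageE imageI)
    then show False
      using fixed_by_jacobson_left[OF fin] nz j x by (simp add: carr)
  qed
  \<comment> \<open>Closure of \<open>Z\<close> under left multiples rests on
    \<open>j(rn) = (jr)n\<close>, where \<open>jr\<close> is again in the radical.\<close>
  define Z where "Z = {n \<in> N. \<forall>j\<in>?J. j \<otimes> n = \<zero>}"
  have "ideal Z R"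
  proof (rule idealI_closed)
    show "a \<oplus> b \<in> Z" if "a \<in> Z" "b \<in> Z" for a b
      using that unfolding Z_def by (simp add: carr r_distr)
    show "r \<otimes> a \<in> Z" if "r \<in> carrier R" "a \<in> Z" for r a
      using that unfolding Z_def by (simp add: N.I_l_closed J.I_r_closed carr flip: m_assoc)
    show "a \<otimes> r \<in> Z" if "r \<in> carrier R" "a \<in> Z" for r a
      using that unfolding Z_def by (simp add: N.I_r_closed carr flip: m_assoc)
  qed (auto simp: Z_def carr)
  moreover have "x \<in> Z"
    using x Jx unfolding Z_def by blast
  ultimately have "Z = N"
    using min[of Z] x unfolding Z_def by blast
  then show "j \<otimes> n = \<zero>"
    using n j unfolding Z_def by blast
  obtain y where y: "y \<in> N - {\<zero>}"
    and y_min: "\<And>x. x \<in> N - {\<zero>} \<Longrightarrow> card ((\<lambda>j. y \<otimes> j) ` ?J) \<le> card ((\<lambda>j. x \<otimes> j) ` ?J)"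
    using ex_has_least_nat[of "\<lambda>x. x \<in> N - {\<zero>}" x0 "\<lambda>x. card ((\<lambda>j. x \<otimes> j) ` ?J)"] x0 by blast
  have yJ: "y \<otimes> j = \<zero>" if j: "j \<in> ?J" for j
  proof (rule ccontr)
    assume nz: "y \<otimes> j \<noteq> \<zero>"
    have "(\<lambda>i. (y \<otimes> j) \<otimes> i) ` ?J \<subseteq> (\<lambda>i. y \<otimes> i) ` ?J"
    proof (rule image_subsetI)
      fix i assume i: "i \<in> ?J"
      have "(y \<otimes> j) \<otimes> i = y \<otimes> (j \<otimes> i)"
        using i j y by (simp add: carr m_assoc)
      then show "(y \<otimes> j) \<otimes> i \<in> (\<lambda>i. y \<otimes> i) ` ?J"
        using J.I_r_closed[OF j J.Icarr[OF i]] by blast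
    qed
    moreover have "y \<otimes> j \<in> N - {\<zero>}"
      using nz y j by (simp add: N.I_r_closed carr)
    ultimately have "(\<lambda>i. (y \<otimes> j) \<otimes> i) ` ?J = (\<lambda>i. y \<otimes> i) ` ?J"
      using y_min \<open>finite ?J\<close> by (intro card_seteq) auto
    then obtain i where "i \<in> ?J" "y \<otimes> j = (y \<otimes> j) \<otimes> i"
      using j by (metis (no_types, lifting) imageE imageI)
    then show False
      using fixed_by_jacobson_right[OF fin] nz j y by (simp add: carr)
  qed
  define W where "W = {n \<in> N. \<forall>j\<in>?J. n \<otimes> j = \<zero>}"
  have "ideal W R"
  proof (rule idealI_closed)
    show "a \<oplus> b \<in> W" if "a \<in> W" "b \<in> W" for a b
      using that unfolding W_def by (simp add: carr l_distr)
    show "r \<otimes> a \<in> W" if "r \<in> carrier R" "a \<in> W" for r a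
      using that unfolding W_def by (simp add: N.I_l_closed carr m_assoc)
    show "a \<otimes> r \<in> W" if "r \<in> carrier R" "a \<in> W" for r a
      using that unfolding W_def by (simp add: N.I_r_closed J.I_l_closed carr m_assoc)
  qed (auto simp: W_def carr)
  moreover have "y \<in> W"
    using y yJ unfolding W_def by blast
  ultimately have "W = N"
    using min[of W] y unfolding W_def by blast
  then show "n \<otimes> j = \<zero>"
    using n j unfolding W_def by blast
qed

lemma commutator_mem_of_Quot_commutative:
  assumes J: "ideal J R" and "cring (R Quot J)" and x: "x \<in> carrier R" and y: "y \<in> carrier R"
  shows "x \<otimes> y \<ominus> y \<otimes> x \<in> J"
proof -
  interpret J: ideal J R by (rule J)
  interpret Q: cring "R Quot J" by fact
  have "J +> (x \<otimes> y) = J +> (y \<otimes> x)"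
    using Q.m_comm[of "J +> x" "J +> y"] x y
    by (auto simp: FactRing_simps J.rcoset_mult_add)
  then have "x \<otimes> y \<in> J +> (y \<otimes> x)"
    using J.a_rcos_self[of "x \<otimes> y"] x y by simp
  then obtain j where "j \<in> J" "x \<otimes> y = j \<oplus> y \<otimes> x"
    by (auto simp: a_r_coset_def')
  then have "x \<otimes> y \<ominus> y \<otimes> x = j"
    using x y J.Icarr by (simp add: minus_eq a_assoc r_neg)
  then show ?thesis using \<open>j \<in> J\<close> by simp
qed

end

section \<open>Minimal ideals of square zero with commuting multiplications\<close>

text \<open>These are the traces that the radical leaves on \<open>N\<close>. The last two
  assumptions say that commutators of \<open>R\<close> kill \<open>N\<close> from either side; the
  left and right actions of one element may still differ.\<close>

locale square_zero_minimal_ideal = ring R + N: ideal N R for N and R (structure) +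
  assumes finite_carrier: "finite (carrier R)"
    and nonzero: "N \<noteq> {\<zero>}"
    and minimal: "\<And>I. \<lbrakk>ideal I R; I \<subseteq> N\<rbrakk> \<Longrightarrow> I = {\<zero>} \<or> I = N"
    and square_zero: "\<And>x y. \<lbrakk>x \<in> N; y \<in> N\<rbrakk> \<Longrightarrow> x \<otimes> y = \<zero>"
    and left_comm: "\<And>r s x. \<lbrakk>r \<in> carrier R; s \<in> carrier R; x \<in> N\<rbrakk> \<Longrightarrow> (r \<otimes> s) \<otimes> x = (s \<otimes> r) \<otimes> x"
    and right_comm: "\<And>r s x. \<lbrakk>r \<in> carrier R; s \<in> carrier R; x \<in> N\<rbrakk> \<Longrightarrow> x \<otimes> (r \<otimes> s) = x \<otimes> (s \<otimes> r)"
begin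

lemma finite_N: "finite N"
  using finite_carrier N.a_subset by (rule rev_finite_subset)

lemma card_N: "1 < card N"
proof -
  obtain x where "x \<in> N" "x \<noteq> \<zero>"
    using nonzero N.zero_closed by blast
  then have "card {\<zero>, x} \<le> card N"
    using finite_N N.zero_closed by (intro card_mono) auto
  then show ?thesis
    using \<open>x \<noteq> \<zero>\<close> by simp
qed

section \<open>Derivations and bimodule endomorphisms\<close>

text \<open>Because products in \<open>N\<close> vanish, the Leibniz rule is compatible with being
  the identity on \<open>N\<close>; projections onto \<open>N\<close> along a complement are of this
  kind.\<close>

definition derivation :: "('a \<Rightarrow> 'a) \<Rightarrow> bool" where
  "derivation d \<longleftrightarrow> d \<in> carrier R \<rightarrow> N \<and>
     (\<forall>r\<in>carrier R. \<forall>s\<in>carrier R. d (r \<oplus> s) = d r \<oplus> d s \<and> d (r \<otimes> s) = r \<otimes> d s \<oplus> d r \<otimes> s)"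

text \<open>Linearity on both sides makes kernels two-sided ideals of \<open>R\<close>, so
  minimality of \<open>N\<close> yields Schur's lemma.\<close>

definition bimodule_endo :: "('a \<Rightarrow> 'a) \<Rightarrow> bool" where
  "bimodule_endo f \<longleftrightarrow> f \<in> N \<rightarrow> N \<and>
     (\<forall>x\<in>N. \<forall>y\<in>N. f (x \<oplus> y) = f x \<oplus> f y) \<and>
     (\<forall>r\<in>carrier R. \<forall>x\<in>N. f (r \<otimes> x) = r \<otimes> f x \<and> f (x \<otimes> r) = f x \<otimes> r)"

lemma derivation_closed: "\<lbrakk>derivation d; r \<in> carrier R\<rbrakk> \<Longrightarrow> d r \<in> N"
  unfolding derivation_def by blast

lemma derivation_carrier: "\<lbrakk>derivation d; r \<in> carrier R\<rbrakk> \<Longrightarrow> d r \<in> carrier R"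
  using derivation_closed N.Icarr by blast

lemma derivation_add:
  "\<lbrakk>derivation d; r \<in> carrier R; s \<in> carrier R\<rbrakk> \<Longrightarrow> d (r \<oplus> s) = d r \<oplus> d s"
  unfolding derivation_def by blast

lemma derivation_mult:
  "\<lbrakk>derivation d; r \<in> carrier R; s \<in> carrier R\<rbrakk> \<Longrightarrow> d (r \<otimes> s) = r \<otimes> d s \<oplus> d r \<otimes> s"
  unfolding derivation_def by blast

lemma derivation_zero:
  assumes "derivation d" shows "d \<zero> = \<zero>"
  using derivation_add[OF assms, of \<zero> \<zero>] derivation_carrier[OF assms, of \<zero>]
  by (metis add.l_cancel_one' zero_closed l_zero)

lemma derivation_multiple:
  assumes "derivation d" "r \<in> carrier R"
  shows "d ([(n::nat)] \<cdot> r) = [n] \<cdot> d r"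
  by (induction n)
    (simp_all add: assms derivation_zero derivation_add add.nat_pow_Suc)

lemma derivation_diff:
  assumes d: "derivation d" and e: "derivation e"
  shows "derivation (\<lambda>r. d r \<ominus> e r)"
  unfolding derivation_def
proof (intro conjI ballI)
  note carr = derivation_carrier[OF d] derivation_carrier[OF e]
  show "(\<lambda>r. d r \<ominus> e r) \<in> carrier R \<rightarrow> N"
    using derivation_closed d e by (auto simp: minus_eq)
  fix r s assume rs: "r \<in> carrier R" "s \<in> carrier R"
  show "d (r \<oplus> s) \<ominus> e (r \<oplus> s) = (d r \<ominus> e r) \<oplus> (d s \<ominus> e s)"
    using rs carr by (simp add: derivation_add[OF d] derivation_add[OF e] minus_eq minus_add a_ac)
  show "d (r \<otimes> s) \<ominus> e (r \<otimes> s) = r \<otimes> (d s \<ominus> e s) \<oplus> (d r \<ominus> e r) \<otimes> s"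
    using rs carr
    by (simp add: derivation_mult[OF d] derivation_mult[OF e] minus_eq minus_add a_ac
        l_distr r_distr l_minus r_minus)
qed

lemma bimodule_endo_closed: "\<lbrakk>bimodule_endo f; x \<in> N\<rbrakk> \<Longrightarrow> f x \<in> N"
  unfolding bimodule_endo_def by blast

lemma bimodule_endo_carrier: "\<lbrakk>bimodule_endo f; x \<in> N\<rbrakk> \<Longrightarrow> f x \<in> carrier R"
  using bimodule_endo_closed N.Icarr by blast

lemma bimodule_endo_add: "\<lbrakk>bimodule_endo f; x \<in> N; y \<in> N\<rbrakk> \<Longrightarrow> f (x \<oplus> y) = f x \<oplus> f y"
  unfolding bimodule_endo_def by blast

lemma bimodule_endo_left: "\<lbrakk>bimodule_endo f; r \<in> carrier R; x \<in> N\<rbrakk> \<Longrightarrow> f (r \<otimes> x) = r \<otimes> f x"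
  unfolding bimodule_endo_def by blast

lemma bimodule_endo_right: "\<lbrakk>bimodule_endo f; r \<in> carrier R; x \<in> N\<rbrakk> \<Longrightarrow> f (x \<otimes> r) = f x \<otimes> r"
  unfolding bimodule_endo_def by blast

lemmas bimodule_endo_simps = bimodule_endo_add bimodule_endo_left bimodule_endo_right

lemma bimodule_endoI:
  assumes "\<And>x. x \<in> N \<Longrightarrow> f x \<in> N"
    and "\<And>x y. \<lbrakk>x \<in> N; y \<in> N\<rbrakk> \<Longrightarrow> f (x \<oplus> y) = f x \<oplus> f y"
    and "\<And>r x. \<lbrakk>r \<in> carrier R; x \<in> N\<rbrakk> \<Longrightarrow> f (r \<otimes> x) = r \<otimes> f x"
    and "\<And>r x. \<lbrakk>r \<in> carrier R; x \<in> N\<rbrakk> \<Longrightarrow> f (x \<otimes> r) = f x \<otimes> r"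
  shows "bimodule_endo f"
  unfolding bimodule_endo_def by (simp add: assms)

lemma bimodule_endo_zero:
  assumes "bimodule_endo f" shows "f \<zero> = \<zero>"
  using bimodule_endo_left[OF assms zero_closed N.zero_closed]
    bimodule_endo_carrier[OF assms N.zero_closed] by simp

lemma derivation_compose:
  assumes f: "bimodule_endo f" and d: "derivation d"
  shows "derivation (\<lambda>r. f (d r))"
  unfolding derivation_def
proof (intro conjI ballI funcsetI)
  fix r s assume rs: "r \<in> carrier R" "s \<in> carrier R"
  note dN = derivation_closed[OF d rs(1)] derivation_closed[OF d rs(2)]
  show "f (d (r \<oplus> s)) = f (d r) \<oplus> f (d s)"
    using rs dN by (simp add: derivation_add[OF d] bimodule_endo_add[OF f])
  show "f (d (r \<otimes> s)) = r \<otimes> f (d s) \<oplus> f (d r) \<otimes> s"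
    using rs dN
    by (simp add: derivation_mult[OF d] bimodule_endo_simps[OF f] N.I_l_closed N.I_r_closed)
qed (simp add: bimodule_endo_closed[OF f] derivation_closed[OF d])

lemma derivation_kernel:
  assumes d: "derivation d"
  shows "nonunital_subring {r \<in> carrier R. d r = \<zero>} R"
  unfolding nonunital_subring_def
proof (intro conjI ballI)
  show "additive_subgroup {r \<in> carrier R. d r = \<zero>} R"
  proof (rule additive_subgroupI_closed)
    fix r assume r: "r \<in> {r \<in> carrier R. d r = \<zero>}"
    then have "d (r \<oplus> \<ominus> r) = d (\<ominus> r)"
      using derivation_carrier[OF d] by (simp add: derivation_add[OF d])
    then show "\<ominus> r \<in> {r \<in> carrier R. d r = \<zero>}"
      using r derivation_zero[OF d] by (simp add: r_neg)
  qed (auto simp: derivation_zero[OF d] derivation_add[OF d])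
qed (auto simp: derivation_mult[OF d])

lemma bimodule_endo_diff:
  assumes f: "bimodule_endo f" and g: "bimodule_endo g"
  shows "bimodule_endo (\<lambda>x. f x \<ominus> g x)"
proof (rule bimodule_endoI)
  note carr = bimodule_endo_carrier[OF f] bimodule_endo_carrier[OF g] N.Icarr
  show "f x \<ominus> g x \<in> N" if "x \<in> N" for x
    using that f g by (simp add: minus_eq bimodule_endo_closed)
  show "f (x \<oplus> y) \<ominus> g (x \<oplus> y) = (f x \<ominus> g x) \<oplus> (f y \<ominus> g y)" if "x \<in> N" "y \<in> N" for x y
    using that carr
    by (simp add: bimodule_endo_add[OF f] bimodule_endo_add[OF g] minus_eq minus_add a_ac)
  show "f (r \<otimes> x) \<ominus> g (r \<otimes> x) = r \<otimes> (f x \<ominus> g x)" if "r \<in> carrier R" "x \<in> N" for r x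
    using that carr
    by (simp add: bimodule_endo_left[OF f] bimodule_endo_left[OF g] minus_eq r_distr r_minus)
  show "f (x \<otimes> r) \<ominus> g (x \<otimes> r) = (f x \<ominus> g x) \<otimes> r" if "r \<in> carrier R" "x \<in> N" for r x
    using that carr
    by (simp add: bimodule_endo_right[OF f] bimodule_endo_right[OF g] minus_eq l_distr l_minus)
qed

text \<open>Schur's lemma: the kernel is an ideal inside \<open>N\<close> containing a nonzero
  element.\<close>

lemma bimodule_endo_eq_zero:
  assumes f: "bimodule_endo f" and x: "x \<in> N" "x \<noteq> \<zero>" "f x = \<zero>" and y: "y \<in> N"
  shows "f y = \<zero>"
proof -
  have "ideal {z \<in> N. f z = \<zero>} R"
    by (intro idealI_closed)
      (auto simp: bimodule_endo_zero[OF f] bimodule_endo_simps[OF f] N.Icarr N.I_l_closed N.I_r_closed)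
  then have "{z \<in> N. f z = \<zero>} = N"
    using minimal[of "{z \<in> N. f z = \<zero>}"] x by auto
  then show ?thesis using y by blast
qed

text \<open>The set of all values \<open>f x\<close> is an ideal: by \<open>left_comm\<close> and
  \<open>right_comm\<close>, following \<open>f\<close> by a left or right multiplication gives
  another bimodule endomorphism. The identity puts \<open>x\<close> into this ideal, so it is
  \<open>N\<close>.\<close>

lemma bimodule_endo_transitive:
  assumes x: "x \<in> N" "x \<noteq> \<zero>" and y: "y \<in> N"
  obtains f where "bimodule_endo f" "f x = y"
proof -
  define H where "H = {f x |f. bimodule_endo f}"
  have HI: "f x \<in> H" if "bimodule_endo f" for f
    using that unfolding H_def by blast
  have HN: "H \<subseteq> N"
    using x bimodule_endo_closed unfolding H_def by blast
  have "ideal H R"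
  proof (rule idealI_closed)
    show "H \<subseteq> carrier R"
      using HN N.a_subset by blast
    have "bimodule_endo (\<lambda>_. \<zero>)"
      by (rule bimodule_endoI) simp_all
    then show "\<zero> \<in> H"
      by (rule HI)
    fix a assume "a \<in> H"
    then obtain f where f: "bimodule_endo f" "a = f x"
      unfolding H_def by blast
    note fN = bimodule_endo_closed[OF f(1)] bimodule_endo_carrier[OF f(1)] N.Icarr
    show "a \<oplus> b \<in> H" if "b \<in> H" for b
    proof -
      obtain g where g: "bimodule_endo g" "b = g x"
        using \<open>b \<in> H\<close> unfolding H_def by blast
      note gN = bimodule_endo_closed[OF g(1)] bimodule_endo_carrier[OF g(1)]
      have "bimodule_endo (\<lambda>z. f z \<oplus> g z)"
        by (rule bimodule_endoI)
          (simp_all add: bimodule_endo_simps[OF f(1)] bimodule_endo_simps[OF g(1)]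
            fN gN a_ac l_distr r_distr)
      then show ?thesis
        unfolding f(2) g(2) by (rule HI)
    qed
    fix r assume r: "r \<in> carrier R"
    have "bimodule_endo (\<lambda>z. r \<otimes> f z)"
    proof (rule bimodule_endoI)
      show "r \<otimes> f (s \<otimes> z) = s \<otimes> (r \<otimes> f z)" if "s \<in> carrier R" "z \<in> N" for s z
        using that left_comm[of r s "f z"] r
        by (simp add: bimodule_endo_left[OF f(1)] fN flip: m_assoc)
    qed (simp_all add: r bimodule_endo_simps[OF f(1)] fN r_distr m_assoc N.I_l_closed)
    then show "r \<otimes> a \<in> H"
      unfolding f(2) by (rule HI)
    have "bimodule_endo (\<lambda>z. f z \<otimes> r)"
    proof (rule bimodule_endoI)
      show "f (z \<otimes> s) \<otimes> r = (f z \<otimes> r) \<otimes> s" if "s \<in> carrier R" "z \<in> N" for s z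
        using that right_comm[of r s "f z"] r
        by (simp add: bimodule_endo_right[OF f(1)] fN m_assoc)
    qed (simp_all add: r bimodule_endo_simps[OF f(1)] fN l_distr m_assoc N.I_r_closed)
    then show "a \<otimes> r \<in> H"
      unfolding f(2) by (rule HI)
  qed
  moreover have "bimodule_endo (\<lambda>z. z)"
    by (rule bimodule_endoI) simp_all
  then have "x \<in> H"
    by (rule HI)
  ultimately have "H = N"
    using minimal[OF _ HN] x by blast
  then have "y \<in> {f x |f. bimodule_endo f}"
    using y unfolding H_def by simp
  then show ?thesis
    using that by auto
qed

lemma cover_by_derivation_kernels:
  assumes \<rho>: "derivation \<rho>" "\<And>x. x \<in> N \<Longrightarrow> \<rho> x = x"
    and D: "derivation D" "\<And>x. x \<in> N \<Longrightarrow> D x = \<zero>"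
    and r0: "r0 \<in> carrier R" "D r0 \<noteq> \<zero>"
  obtains C where "cover R C" "finite C" "card C \<le> card N + 1"
    "\<forall>S\<in>C. \<exists>d. derivation d \<and> S = {r \<in> carrier R. d r = \<zero>}"
proof -
  let ?K = "\<lambda>d. {r \<in> carrier R. d r = \<zero>}"
  \<comment> \<open>The value at the fixed nonzero element \<open>D r0\<close> lets \<open>N\<close>
    itself index the endomorphisms.\<close>
  have "\<forall>y\<in>N. \<exists>f. bimodule_endo f \<and> f (D r0) = y"
    using bimodule_endo_transitive[OF derivation_closed[OF D(1) r0(1)] r0(2)] by metis
  then obtain F where F: "\<And>y. y \<in> N \<Longrightarrow> bimodule_endo (F y)" "\<And>y. y \<in> N \<Longrightarrow> F y (D r0) = y"
    by metis
  define d where "d y r = \<rho> r \<ominus> F y (D r)" for y r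
  have d: "derivation (d y)" if "y \<in> N" for y
    unfolding d_def by (rule derivation_diff[OF \<rho>(1) derivation_compose[OF F(1)[OF that] D(1)]])
  note FN = bimodule_endo_closed[OF F(1)] bimodule_endo_carrier[OF F(1)]
  define C where "C = insert (?K D) ((\<lambda>y. ?K (d y)) ` N)"
  obtain x where x: "x \<in> N" "x \<noteq> \<zero>"
    using nonzero N.zero_closed by blast
  have der: "\<exists>e. derivation e \<and> S = ?K e" if "S \<in> C" for S
    using that d D(1) unfolding C_def by blast
  \<comment> \<open>As \<open>D\<close> vanishes on \<open>N\<close>, each \<open>d y\<close> is
    still the identity there.\<close>
  have "x \<notin> ?K (d y)" if "y \<in> N" for y
    using x that \<rho>(2) D(2) bimodule_endo_zero[OF F(1)] by (simp add: d_def minus_eq N.Icarr)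
  moreover have "r0 \<notin> ?K D"
    using r0 by simp
  ultimately have proper: "S \<noteq> carrier R" if "S \<in> C" for S
    using that x N.Icarr r0(1) unfolding C_def by blast
  have "r \<in> \<Union>C" if r: "r \<in> carrier R" for r
  proof (cases "D r = \<zero>")
    case True
    then show ?thesis using r unfolding C_def by blast
  next
    case False
    have DrN: "D r \<in> N" using derivation_closed[OF D(1) r] .
    \<comment> \<open>If \<open>F y\<close> and \<open>F z\<close> agree at \<open>D r\<close>,
      which is nonzero, they agree at \<open>D r0\<close>, where their values are \<open>y\<close>
      and \<open>z\<close>. Being injective on the finite set \<open>N\<close>, the map reaches
      \<open>\<rho> r\<close>.\<close>
    have "inj_on (\<lambda>y. F y (D r)) N"
    proof (rule inj_onI)
      fix y z assume yz: "y \<in> N" "z \<in> N" "F y (D r) = F z (D r)"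
      have "bimodule_endo (\<lambda>x. F y x \<ominus> F z x)"
        by (rule bimodule_endo_diff[OF F(1)[OF yz(1)] F(1)[OF yz(2)]])
      moreover have "F y (D r) \<ominus> F z (D r) = \<zero>"
        using yz FN[OF _ DrN] by (simp add: minus_eq r_neg)
      ultimately have "F y (D r0) \<ominus> F z (D r0) = \<zero>"
        using bimodule_endo_eq_zero[of "\<lambda>x. F y x \<ominus> F z x" "D r" "D r0"]
          DrN False derivation_closed[OF D(1) r0(1)] by blast
      then show "y = z"
        using F(2) yz N.Icarr by simp
    qed
    then have "(\<lambda>y. F y (D r)) ` N = N"
      using FN DrN finite_N by (intro endo_inj_surj) auto
    then obtain y where y: "y \<in> N" "F y (D r) = \<rho> r"
      using derivation_closed[OF \<rho>(1) r] by (metis (no_types, lifting) imageE)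
    then have "d y r = \<zero>"
      using derivation_carrier[OF \<rho>(1) r] by (simp add: d_def minus_eq r_neg)
    then show ?thesis using r y unfolding C_def by blast
  qed
  then have "cover R C"
    unfolding cover_def using derivation_kernel der proper by fastforce
  moreover have "finite C"
    unfolding C_def using finite_N by simp
  moreover have "card C \<le> card N + 1"
  proof -
    have "card C \<le> Suc (card ((\<lambda>y. ?K (d y)) ` N))"
      unfolding C_def by (rule card_insert_le_m1) (simp_all)
    then show ?thesis
      using card_image_le[OF finite_N, of "\<lambda>y. ?K (d y)"] by linarith
  qed
  ultimately show ?thesis
    using that[of C] der by simp
qed

section \<open>Complements\<close>

text \<open>Writing \<open>r = s + n\<close>, the part \<open>n\<close> kills \<open>N\<close>, so
  \<open>r\<close> acts on \<open>S \<inter> N\<close> as \<open>s\<close> does and this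
  intersection is an ideal. It is not \<open>N\<close>, since \<open>S\<close> would then absorb
  \<open>N\<close> and be all of \<open>R\<close>.\<close>

lemma sum_with_N_carrier_imp_complement:
  assumes S: "nonunital_subring S R" "S \<noteq> carrier R" and sum: "S <+>\<^bsub>R\<^esub> N = carrier R"
  shows "S \<inter> N = {\<zero>}"
proof -
  interpret S: additive_subgroup S R
    using S(1) unfolding nonunital_subring_def by blast
  have mult: "a \<otimes> b \<in> S" if "a \<in> S" "b \<in> S" for a b
    using S(1) that unfolding nonunital_subring_def by blast
  have carr: "s \<in> carrier R" if "s \<in> S" for s
    using that S.a_subset by blast
  have "ideal (S \<inter> N) R"
  proof (rule idealI_closed)
    fix r x assume rx: "r \<in> carrier R" "x \<in> S \<inter> N"
    then obtain s n where sn: "s \<in> S" "n \<in> N" "r = s \<oplus> n"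
      using sum unfolding set_add_def' by blast
    then have "r \<otimes> x = s \<otimes> x" "x \<otimes> r = x \<otimes> s"
      using rx by (simp_all add: l_distr r_distr carr N.Icarr square_zero)
    then show "r \<otimes> x \<in> S \<inter> N" "x \<otimes> r \<in> S \<inter> N"
      using mult sn rx N.I_l_closed N.I_r_closed by auto
  qed (auto simp: S.zero_closed S.a_closed carr)
  then have "S \<inter> N = {\<zero>} \<or> S \<inter> N = N"
    by (intro minimal) auto
  moreover have "S \<inter> N \<noteq> N"
  proof
    assume "S \<inter> N = N"
    then have "S <+>\<^bsub>R\<^esub> N \<subseteq> S"
      using S.a_closed unfolding set_add_def' by blast
    then show False
      using sum S(2) S.a_subset by blast
  qed
  ultimately show ?thesis by blast
qed

text \<open>\<open>\<rho>\<close> is the projection onto \<open>N\<close> along \<open>S\<close>. It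
  obeys the Leibniz rule because the product of two \<open>N\<close>-parts is zero.\<close>

lemma complement_derivation:
  assumes S: "nonunital_subring S R" and sum: "S <+>\<^bsub>R\<^esub> N = carrier R" and int: "S \<inter> N = {\<zero>}"
  obtains \<rho> where "derivation \<rho>" "\<And>x. x \<in> N \<Longrightarrow> \<rho> x = x" "{r \<in> carrier R. \<rho> r = \<zero>} = S"
proof -
  interpret S: additive_subgroup S R
    using S(1) unfolding nonunital_subring_def by blast
  have mult: "a \<otimes> b \<in> S" if "a \<in> S" "b \<in> S" for a b
    using S(1) that unfolding nonunital_subring_def by blast
  have carr: "s \<in> carrier R" if "s \<in> S" for s
    using that S.a_subset by blast
  have "\<exists>s n. s \<in> S \<and> n \<in> N \<and> r = s \<oplus> n" if "r \<in> carrier R" for r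
    using sum that unfolding set_add_def' by blast
  then obtain \<pi> \<rho> where \<pi>: "\<And>r. r \<in> carrier R \<Longrightarrow> \<pi> r \<in> S"
    and \<rho>: "\<And>r. r \<in> carrier R \<Longrightarrow> \<rho> r \<in> N"
    and decomp: "\<And>r. r \<in> carrier R \<Longrightarrow> r = \<pi> r \<oplus> \<rho> r"
    by metis
  have unique: "\<rho> (s \<oplus> n) = n" if "s \<in> S" "n \<in> N" for s n
  proof -
    let ?r = "s \<oplus> n"
    have r: "?r \<in> carrier R" using that carr N.Icarr by simp
    have c: "\<pi> ?r \<in> carrier R" "\<rho> ?r \<in> carrier R" "s \<in> carrier R" "n \<in> carrier R"
      using carr N.Icarr \<pi>[OF r] \<rho>[OF r] that by auto
    have "\<ominus> s \<oplus> \<pi> ?r = (\<ominus> s \<oplus> (\<pi> ?r \<oplus> \<rho> ?r)) \<ominus> \<rho> ?r"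
      using c by (simp add: minus_eq a_assoc r_neg)
    also have "\<dots> = n \<ominus> \<rho> ?r"
      unfolding decomp[OF r, symmetric] using c by (simp add: l_neg flip: a_assoc)
    \<comment> \<open>The left side lies in \<open>S\<close> and the right side in \<open>N\<close>,
      so both are zero.\<close>
    finally have eq: "\<ominus> s \<oplus> \<pi> ?r = n \<ominus> \<rho> ?r" .
    moreover have "\<ominus> s \<oplus> \<pi> ?r \<in> S"
      using \<pi>[OF r] that by (simp add: S.a_closed S.a_inv_closed)
    moreover have "n \<ominus> \<rho> ?r \<in> N"
      using \<rho>[OF r] that by (simp add: minus_eq)
    ultimately have "n \<ominus> \<rho> ?r = \<zero>"
      using int by auto
    then show ?thesis using c by simp
  qed
  have fixes_N: "\<rho> x = x" if "x \<in> N" for x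
    using unique[of \<zero> x] that by (simp add: S.zero_closed N.Icarr)
  have "derivation \<rho>"
    unfolding derivation_def
  proof (intro conjI ballI)
    show "\<rho> \<in> carrier R \<rightarrow> N" using \<rho> by blast
    fix r s assume rs: "r \<in> carrier R" "s \<in> carrier R"
    note c = rs carr[OF \<pi>[OF rs(1)]] carr[OF \<pi>[OF rs(2)]] N.Icarr[OF \<rho>[OF rs(1)]] N.Icarr[OF \<rho>[OF rs(2)]]
    have "r \<oplus> s = (\<pi> r \<oplus> \<rho> r) \<oplus> (\<pi> s \<oplus> \<rho> s)"
      using decomp rs by simp
    also have "\<dots> = (\<pi> r \<oplus> \<pi> s) \<oplus> (\<rho> r \<oplus> \<rho> s)"
      using c by (simp add: a_ac)
    finally have "\<rho> (r \<oplus> s) = \<rho> ((\<pi> r \<oplus> \<pi> s) \<oplus> (\<rho> r \<oplus> \<rho> s))"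
      by (rule arg_cong)
    then show "\<rho> (r \<oplus> s) = \<rho> r \<oplus> \<rho> s"
      using \<pi> \<rho> rs by (simp add: unique S.a_closed)
    have l: "r \<otimes> \<rho> s = \<pi> r \<otimes> \<rho> s"
    proof -
      have "r \<otimes> \<rho> s = (\<pi> r \<oplus> \<rho> r) \<otimes> \<rho> s"
        using decomp rs by simp
      then show ?thesis
        using c \<rho> rs by (simp add: l_distr square_zero)
    qed
    have "r \<otimes> s = (\<pi> r \<oplus> \<rho> r) \<otimes> s"
      using decomp rs by simp
    also have "\<dots> = \<pi> r \<otimes> s \<oplus> \<rho> r \<otimes> s"
      using c by (simp add: l_distr)
    also have "\<pi> r \<otimes> s = \<pi> r \<otimes> (\<pi> s \<oplus> \<rho> s)"
      using decomp rs by simp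
    also have "\<dots> = \<pi> r \<otimes> \<pi> s \<oplus> \<pi> r \<otimes> \<rho> s"
      using c by (simp add: r_distr)
    \<comment> \<open>The first summand is in \<open>S\<close> and the bracket in \<open>N\<close>,
      so \<open>unique\<close> reads off the value of \<open>\<rho>\<close>.\<close>
    finally have "r \<otimes> s = \<pi> r \<otimes> \<pi> s \<oplus> (r \<otimes> \<rho> s \<oplus> \<rho> r \<otimes> s)"
      using c l by (simp add: a_assoc)
    then have "\<rho> (r \<otimes> s) = \<rho> (\<pi> r \<otimes> \<pi> s \<oplus> (r \<otimes> \<rho> s \<oplus> \<rho> r \<otimes> s))"
      by (rule arg_cong)
    then show "\<rho> (r \<otimes> s) = r \<otimes> \<rho> s \<oplus> \<rho> r \<otimes> s"
      using \<pi> \<rho> rs mult by (simp add: unique N.I_l_closed N.I_r_closed)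
  qed
  moreover have "{r \<in> carrier R. \<rho> r = \<zero>} = S"
  proof
    show "{r \<in> carrier R. \<rho> r = \<zero>} \<subseteq> S"
    proof
      fix r assume "r \<in> {r \<in> carrier R. \<rho> r = \<zero>}"
      then have r: "r \<in> carrier R" "\<rho> r = \<zero>" by simp_all
      have "\<pi> r = r"
        using decomp[OF r(1), symmetric] r(2) carr[OF \<pi>[OF r(1)]] by simp
      then show "r \<in> S" using \<pi>[OF r(1)] by simp
    qed
    show "S \<subseteq> {r \<in> carrier R. \<rho> r = \<zero>}"
    proof
      fix s assume s: "s \<in> S"
      then show "s \<in> {r \<in> carrier R. \<rho> r = \<zero>}"
        using unique[OF s N.zero_closed] carr[OF s] by simp
    qed
  qed
  ultimately show ?thesis
    using that[of \<rho>] fixes_N by simp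
qed

lemma complement_meets_coset_once:
  assumes S: "nonunital_subring S R" "S \<inter> N = {\<zero>}" and x: "x \<in> carrier R"
    and n: "n \<in> N" "m \<in> N" "x \<oplus> n \<in> S" "x \<oplus> m \<in> S"
  shows "n = m"
proof -
  interpret S: additive_subgroup S R
    using S(1) unfolding nonunital_subring_def by blast
  have c: "n \<in> carrier R" "m \<in> carrier R" using n N.Icarr by auto
  have "n \<ominus> m = (n \<oplus> x) \<oplus> (\<ominus> x \<oplus> \<ominus> m)"
    using c x by (simp add: minus_eq a_assoc r_neg2)
  also have "\<dots> = (x \<oplus> n) \<oplus> \<ominus> (x \<oplus> m)"
    using c x by (simp add: minus_add a_comm[of x n])
  finally have "n \<ominus> m = (x \<oplus> n) \<oplus> \<ominus> (x \<oplus> m)" .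
  then have "n \<ominus> m \<in> S"
    using n by (simp add: S.a_closed S.a_inv_closed)
  moreover have "n \<ominus> m \<in> N"
    using n by (simp add: minus_eq)
  ultimately have "n \<ominus> m = \<zero>"
    using S(2) by blast
  then show ?thesis using c by simp
qed

section \<open>The covering number in terms of the size of the minimal ideal\<close>

lemma minimal_cover_complements:
  assumes C: "cover R C" "finite C" "enat (card C) < sigma (R Quot N)"
  shows "card N < card C" "card N \<le> card {S \<in> C. S <+>\<^bsub>R\<^esub> N = carrier R}"
proof -
  define A where "A = {S \<in> C. S <+>\<^bsub>R\<^esub> N \<noteq> carrier R}"
  define B where "B = {S \<in> C. S <+>\<^bsub>R\<^esub> N = carrier R}"
  have split: "C = A \<union> B" "A \<inter> B = {}" unfolding A_def B_def by auto
  have fin: "finite A" "finite B" using C(2) unfolding A_def B_def by auto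
  have sub: "nonunital_subring S R" "S \<noteq> carrier R" if "S \<in> C" for S
    using C(1) that unfolding cover_def by auto
  have int: "S \<inter> N = {\<zero>}" if "S \<in> B" for S
    using that sub sum_with_N_carrier_imp_complement unfolding B_def by blast
  \<comment> \<open>Otherwise the members of \<open>A\<close> would induce a cover of the quotient
    by \<open>N\<close> that is too small.\<close>
  have "\<not> carrier R \<subseteq> (\<Union>S\<in>A. S <+>\<^bsub>R\<^esub> N)"
  proof
    assume "carrier R \<subseteq> (\<Union>S\<in>A. S <+>\<^bsub>R\<^esub> N)"
    then have "sigma (R Quot N) \<le> enat (card A)"
      using fin sub by (intro sigma_quotient_le_card[OF N.is_ideal]) (auto simp: A_def)
    also have "\<dots> \<le> enat (card C)"
      using C(2) by (simp add: A_def card_mono)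
    finally show False using C(3) by simp
  qed
  then obtain x where x: "x \<in> carrier R" "x \<notin> (\<Union>S\<in>A. S <+>\<^bsub>R\<^esub> N)" by blast
  have "\<exists>S\<in>B. x \<oplus> n \<in> S" if n: "n \<in> N" for n
  proof -
    have nc: "n \<in> carrier R" using n N.Icarr by blast
    then have "x \<oplus> n \<in> \<Union>C"
      using C(1) x unfolding cover_def by simp
    then obtain S where S: "S \<in> C" "x \<oplus> n \<in> S" by blast
    have "S \<notin> A"
    proof
      assume "S \<in> A"
      have "x = (x \<oplus> n) \<oplus> \<ominus> n"
        using x nc by (simp add: a_assoc r_neg)
      moreover have "\<ominus> n \<in> N" using n by simp
      ultimately have "x \<in> S <+>\<^bsub>R\<^esub> N"
        using S unfolding set_add_def' by blast
      then show False using x \<open>S \<in> A\<close> by blast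
    qed
    then show ?thesis using S split by blast
  qed
  then obtain g where g: "\<And>n. n \<in> N \<Longrightarrow> g n \<in> B" "\<And>n. n \<in> N \<Longrightarrow> x \<oplus> n \<in> g n"
    by metis
  \<comment> \<open>A complement contains at most one element of the coset of \<open>x\<close>, so
    different elements require different complements.\<close>
  have "inj_on g N"
  proof (rule inj_onI)
    fix n m assume nm: "n \<in> N" "m \<in> N" "g n = g m"
    have "g n \<in> C" using g(1)[OF nm(1)] unfolding B_def by blast
    then show "n = m"
      using complement_meets_coset_once[of "g n" x n m] sub(1) int g nm x by metis
  qed
  then have NB: "card N \<le> card B"
    using g(1) fin by (intro card_inj_on_le) auto
  then show "card N \<le> card {S \<in> C. S <+>\<^bsub>R\<^esub> N = carrier R}"
    unfolding B_def .
  \<comment> \<open>Complements meet \<open>N\<close> only in zero; covering the rest of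
    \<open>N\<close> takes at least one further member, which makes the bound strict.\<close>
  have "A \<noteq> {}"
  proof
    assume "A = {}"
    obtain n where n: "n \<in> N" "n \<noteq> \<zero>"
      using nonzero N.zero_closed by blast
    then have "n \<in> \<Union>C"
      using C(1) N.Icarr unfolding cover_def by simp
    then show False
      using n int split \<open>A = {}\<close> by blast
  qed
  then have "0 < card A"
    using fin by (simp add: card_gt_0_iff)
  then show "card N < card C"
    using NB split fin by (simp add: card_Un_disjoint)
qed

text \<open>The lower bound for a least cover \<open>C0\<close> meets the size of the cover built
  from two of its complements. The cover returned is the latter, because its members being
  derivation kernels later determines the characteristic.\<close>

lemma sigma_eq_card_N_plus_one:
  assumes "coverable R" "sigma R < sigma (R Quot N)"
  obtains C where "cover R C" "finite C" "sigma R = enat (card C)" "card C = card N + 1"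
    "\<forall>S\<in>C. \<exists>d. derivation d \<and> S = {r \<in> carrier R. d r = \<zero>}"
proof -
  obtain C0 where C0: "cover R C0" "finite C0" "sigma R = enat (card C0)"
    using sigma_attained[OF assms(1) finite_carrier] by blast
  let ?B = "{S \<in> C0. S <+>\<^bsub>R\<^esub> N = carrier R}"
  have low: "card N < card C0" and B: "card N \<le> card ?B"
    using minimal_cover_complements[OF C0(1,2)] assms(2) C0(3) by auto
  have compl: "\<exists>\<rho>. derivation \<rho> \<and> (\<forall>x\<in>N. \<rho> x = x) \<and> {r \<in> carrier R. \<rho> r = \<zero>} = S"
    if "S \<in> ?B" for S
  proof -
    have S: "nonunital_subring S R" "S \<noteq> carrier R" "S <+>\<^bsub>R\<^esub> N = carrier R"
      using that C0(1) unfolding cover_def by auto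
    show ?thesis
      by (rule complement_derivation[OF S(1,3) sum_with_N_carrier_imp_complement[OF S]]) blast
  qed
  \<comment> \<open>There are at least \<open>card N\<close> complements in \<open>C0\<close>, and
    \<open>card N\<close> exceeds one.\<close>
  have "\<exists>S\<in>?B. \<exists>T\<in>?B. S \<noteq> T"
  proof (rule ccontr)
    assume "\<not> ?thesis"
    then have "card ?B \<le> Suc 0"
      by (subst card_le_Suc0_iff_eq) (use C0(2) in auto)
    then show False using B card_N by simp
  qed
  then obtain S T where ST: "S \<in> ?B" "T \<in> ?B" "S \<noteq> T" by blast
  obtain \<rho> where \<rho>: "derivation \<rho>" "\<And>x. x \<in> N \<Longrightarrow> \<rho> x = x" "{r \<in> carrier R. \<rho> r = \<zero>} = S"
    using compl[OF ST(1)] by blast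
  obtain \<rho>' where \<rho>': "derivation \<rho>'" "\<And>x. x \<in> N \<Longrightarrow> \<rho>' x = x" "{r \<in> carrier R. \<rho>' r = \<zero>} = T"
    using compl[OF ST(2)] by blast
  \<comment> \<open>Different kernels force different derivations, so their difference can serve as
    \<open>D\<close>.\<close>
  have "\<exists>r\<in>carrier R. \<rho> r \<noteq> \<rho>' r"
  proof (rule ccontr)
    assume "\<not> ?thesis"
    then have "{r \<in> carrier R. \<rho> r = \<zero>} = {r \<in> carrier R. \<rho>' r = \<zero>}" by auto
    then show False using ST(3) \<rho>(3) \<rho>'(3) by simp
  qed
  then obtain r0 where r0: "r0 \<in> carrier R" "\<rho> r0 \<noteq> \<rho>' r0" by blast
  have D_r0: "\<rho> r0 \<ominus> \<rho>' r0 \<noteq> \<zero>"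
    using r0 derivation_carrier \<rho>(1) \<rho>'(1) by simp
  have D_N: "\<rho> x \<ominus> \<rho>' x = \<zero>" if "x \<in> N" for x
    using that \<rho>(2) \<rho>'(2) N.Icarr by (simp add: minus_eq r_neg)
  obtain C where C: "cover R C" "finite C" "card C \<le> card N + 1"
    "\<forall>S\<in>C. \<exists>d. derivation d \<and> S = {r \<in> carrier R. d r = \<zero>}"
    by (rule cover_by_derivation_kernels
        [OF \<rho>(1,2) derivation_diff[OF \<rho>(1) \<rho>'(1)] D_N r0(1) D_r0])
  have "card C0 \<le> card C"
    using sigma_le_card[OF C(1,2)] C0(3) by simp
  then have "sigma R = enat (card C)" "card C = card N + 1"
    using low C(3) C0(3) by auto
  then show ?thesis
    by (rule that[OF C(1,2) _ _ C(4)])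
qed

section \<open>Prime characteristic\<close>

text \<open>For a prime \<open>p\<close> dividing the additive order of a nonzero \<open>x\<close>,
  the elements of \<open>N\<close> killed by \<open>p\<close> form a nonzero ideal, which is
  \<open>N\<close> by minimality.\<close>

lemma prime_annihilates_N:
  obtains p :: nat where "normalization_semidom_class.prime p" "\<And>x. x \<in> N \<Longrightarrow> [p] \<cdot> x = \<zero>"
proof -
  obtain x where x: "x \<in> N" "x \<noteq> \<zero>"
    using nonzero N.zero_closed by blast
  have xc: "x \<in> carrier R" using x N.Icarr by blast
  have multN: "[(n::nat)] \<cdot> y \<in> N" if "y \<in> N" for n y
    by (induction n) (simp_all add: that add.nat_pow_Suc N.a_closed)
  have "add.ord x \<noteq> 1"
    using x add.ord_eq_1[OF xc] by simp
  then obtain p where p: "normalization_semidom_class.prime p" "p dvd add.ord x"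
    using prime_factor_nat by blast
  \<comment> \<open>\<open>[k] \<cdot> x\<close> is the nonzero element killed by
    \<open>p\<close>.\<close>
  define k where "k = add.ord x div p"
  have k: "add.ord x = k * p" using p unfolding k_def by simp
  have "add.ord x > 0"
    using add.ord_ge_1[OF _ xc] finite_carrier by simp
  then have "k > 0" "k < add.ord x"
    using k prime_gt_1_nat[OF p(1)] by auto
  then have nz: "[k] \<cdot> x \<noteq> \<zero>"
    using add.pow_eq_id[OF xc] nat_dvd_not_less by blast
  have pk: "[p] \<cdot> ([k] \<cdot> x) = \<zero>"
    using xc k add.pow_ord_eq_1[OF xc] by (simp add: add.nat_pow_pow)
  have "ideal {y \<in> N. [p] \<cdot> y = \<zero>} R"
  proof (rule idealI_closed)
    fix r y assume "r \<in> carrier R" "y \<in> {y \<in> N. [p] \<cdot> y = \<zero>}"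
    then have ry: "r \<in> carrier R" "y \<in> carrier R" "y \<in> N" "[p] \<cdot> y = \<zero>"
      using N.Icarr by auto
    show "r \<otimes> y \<in> {y \<in> N. [p] \<cdot> y = \<zero>}"
      using ry by (simp add: N.I_l_closed flip: add_pow_rdistr)
    show "y \<otimes> r \<in> {y \<in> N. [p] \<cdot> y = \<zero>}"
      using ry by (simp add: N.I_r_closed flip: add_pow_ldistr)
  qed (auto simp: N.Icarr N.a_closed add.nat_pow_distrib)
  moreover have "[k] \<cdot> x \<in> {y \<in> N. [p] \<cdot> y = \<zero>}"
    using pk multN x by blast
  ultimately have "{y \<in> N. [p] \<cdot> y = \<zero>} = N"
    using minimal[of "{y \<in> N. [p] \<cdot> y = \<zero>}"] nz by auto
  then show ?thesis
    using that p(1) by blast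
qed

lemma sigma_elementary_prime_characteristic:
  assumes elem: "sigma_elementary R"
  obtains p :: nat and d where "normalization_semidom_class.prime p" "\<And>r. r \<in> carrier R \<Longrightarrow> [p] \<cdot> r = \<zero>"
    "d > 0" "sigma R = enat (p ^ d + 1)"
proof -
  have cov: "coverable R"
    and less: "\<And>I. ideal I R \<Longrightarrow> I \<noteq> {\<zero>} \<Longrightarrow> sigma R < sigma (R Quot I)"
    using elem unfolding sigma_elementary_def by auto
  obtain C where C: "cover R C" "finite C" "sigma R = enat (card C)" "card C = card N + 1"
    "\<forall>S\<in>C. \<exists>d. derivation d \<and> S = {r \<in> carrier R. d r = \<zero>}"
    by (rule sigma_eq_card_N_plus_one[OF cov less[OF N.is_ideal nonzero]])
  obtain p :: nat where p: "normalization_semidom_class.prime p" "\<And>x. x \<in> N \<Longrightarrow> [p] \<cdot> x = \<zero>"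
    using prime_annihilates_N by blast
  define P where "P = {[p] \<cdot> r |r. r \<in> carrier R}"
  have "ideal P R"
  proof (rule idealI_closed)
    show "\<zero> \<in> P"
      unfolding P_def using add.nat_pow_one[of p] zero_closed by (metis (mono_tags, lifting) mem_Collect_eq)
    show "x \<oplus> y \<in> P" if xy: "x \<in> P" "y \<in> P" for x y
    proof -
      obtain a b where ab: "a \<in> carrier R" "b \<in> carrier R" "x = [p] \<cdot> a" "y = [p] \<cdot> b"
        using xy unfolding P_def by blast
      then have "x \<oplus> y = [p] \<cdot> (a \<oplus> b)"
        by (simp add: add.nat_pow_distrib)
      then show ?thesis
        unfolding P_def using a_closed[OF ab(1,2)] by blast
    qed
    fix r x assume r: "r \<in> carrier R" and "x \<in> P"
    then obtain y where y: "y \<in> carrier R" "x = [p] \<cdot> y"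
      unfolding P_def by blast
    have "r \<otimes> x = [p] \<cdot> (r \<otimes> y)" "x \<otimes> r = [p] \<cdot> (y \<otimes> r)"
      unfolding y(2) by (simp_all only: add_pow_rdistr add_pow_ldistr r y(1))
    then show "r \<otimes> x \<in> P" "x \<otimes> r \<in> P"
      unfolding P_def using m_closed[OF r y(1)] m_closed[OF y(1) r] by blast+
  qed (auto simp: P_def)
  have "P = {\<zero>}"
  proof (rule ccontr)
    assume "P \<noteq> {\<zero>}"
    have sub: "nonunital_subring S R" "S \<noteq> carrier R" if "S \<in> C" for S
      using C(1) that unfolding cover_def by auto
    have PS: "S <+>\<^bsub>R\<^esub> P = S" if SC: "S \<in> C" for S
    proof -
      interpret S: additive_subgroup S R
        using sub(1)[OF SC] unfolding nonunital_subring_def by blast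
      obtain d where d: "derivation d" "S = {r \<in> carrier R. d r = \<zero>}"
        using bspec[OF C(5) SC] by blast
      \<comment> \<open>Here \<open>d([p]r) = [p](d r) = 0\<close>, since \<open>d r\<close> lies in
        \<open>N\<close>.\<close>
      have "P \<subseteq> S"
        using p(2) derivation_closed[OF d(1)] unfolding P_def d(2)
        by (auto simp: derivation_multiple[OF d(1)])
      then have "S <+>\<^bsub>R\<^esub> P \<subseteq> S"
        using S.a_closed unfolding set_add_def' by blast
      moreover have "s \<in> S <+>\<^bsub>R\<^esub> P" if "s \<in> S" for s
      proof -
        have "s = s \<oplus> \<zero>" "\<zero> \<in> P"
          using that S.a_subset \<open>ideal P R\<close>
          by (auto intro: additive_subgroup.zero_closed ideal.axioms(1))
        then show ?thesis using that unfolding set_add_def' by blast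
      qed
      ultimately show ?thesis by blast
    qed
    \<comment> \<open>Adding \<open>P\<close> changes no member, so the least cover \<open>C\<close>
      descends to the quotient by \<open>P\<close>, against the \<sigma>-elementary
      property.\<close>
    have "(\<Union>S\<in>C. S <+>\<^bsub>R\<^esub> P) = \<Union>C"
      using PS by simp
    also have "\<dots> = carrier R"
      using C(1) unfolding cover_def by simp
    finally have "sigma (R Quot P) \<le> enat (card C)"
      by (intro sigma_quotient_le_card[OF \<open>ideal P R\<close> C(2) sub(1)])
        (simp_all add: PS sub(2))
    then show False
      using less[OF \<open>ideal P R\<close> \<open>P \<noteq> {\<zero>}\<close>] unfolding C(3) by (rule leD[THEN notE])
  qed
  have pR: "[p] \<cdot> r = \<zero>" if "r \<in> carrier R" for r
  proof -
    have "[p] \<cdot> r \<in> P"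
      unfolding P_def using that by blast
    then show ?thesis
      using \<open>P = {\<zero>}\<close> by simp
  qed
  \<comment> \<open>The additive group now has exponent \<open>p\<close>, so its order and, by
    Lagrange, that of \<open>N\<close> are powers of \<open>p\<close>.\<close>
  obtain k where k: "order (add_monoid R) = p ^ k"
    using add.order_eq_prime_power[OF _ p(1)] finite_carrier pR by auto
  have "card N dvd order (add_monoid R)"
    using add.lagrange[OF N.a_subgroup] by (metis dvd_triv_right)
  then obtain d where d: "card N = p ^ d"
    unfolding k using divides_primepow_nat[OF p(1)] by blast
  have "d > 0"
    using d card_N by (cases d) auto
  then show ?thesis
    using that p(1) pR C(3,4) d by simp
qed

end

text \<open>The characteristic is the additive order of \<open>\<one>\<close>, a divisor of
  \<open>p\<close> other than 1. The zero ring, of characteristic 1, is excluded by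
  \<open>\<one> \<noteq> \<zero>\<close>.\<close>

lemma (in ring) characteristic_eq_prime:
  fixes p :: nat
  assumes "normalization_semidom_class.prime p" "[p] \<cdot> \<one> = \<zero>" "\<one> \<noteq> \<zero>"
  shows "characteristic R = p"
proof -
  have eq: "[n] \<cdot> \<one> = \<zero> \<longleftrightarrow> add.ord \<one> dvd n" for n :: nat
    using add.pow_eq_id[of \<one> n] by simp
  have "add.ord \<one> \<noteq> 1"
    using assms(3) add.ord_eq_1[OF one_closed] by simp
  then have "add.ord \<one> = p"
    using assms(1,2) eq by (metis prime_nat_iff)
  then have "(LEAST n::nat. n > 0 \<and> [n] \<cdot> \<one> = \<zero>) = p"
    unfolding eq using prime_gt_0_nat[OF assms(1)]
    by (intro Least_equality) (auto dest: dvd_imp_le)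
  moreover have "\<exists>n::nat. n > 0 \<and> [n] \<cdot> \<one> = \<zero>"
    using assms(2) prime_gt_0_nat[OF assms(1)] by blast
  ultimately show ?thesis
    unfolding characteristic_def by simp
qed

section \<open>Passage from the radical to a minimal ideal\<close>

theorem theorem1p4:
  fixes R :: "('a, 'b) ring_scheme"
  assumes "ring R"
    and "finite (carrier R)"
    and "sigma_elementary R"
    and "cring (R Quot jacobson_radical R)"
    and "jacobson_radical R \<noteq> {\<zero>\<^bsub>R\<^esub>}"
  shows "\<exists>d::nat. d > 0 \<and> sigma R = enat (characteristic R ^ d + 1)"
proof -
  interpret ring R by (rule assms(1))
  let ?J = "jacobson_radical R"
  have J: "ideal ?J R" by (rule ideal_jacobson_radical[OF assms(2)])
  obtain N where N: "ideal N R" "N \<subseteq> ?J" "N \<noteq> {\<zero>\<^bsub>R\<^esub>}"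
    and min: "\<And>I. \<lbrakk>ideal I R; I \<subseteq> N\<rbrakk> \<Longrightarrow> I = {\<zero>\<^bsub>R\<^esub>} \<or> I = N"
    using minimal_ideal_exists[OF assms(2) J assms(5)] by blast
  interpret N: ideal N R by (rule N(1))
  have annihil: "j \<otimes>\<^bsub>R\<^esub> n = \<zero>\<^bsub>R\<^esub>" "n \<otimes>\<^bsub>R\<^esub> j = \<zero>\<^bsub>R\<^esub>" if "j \<in> ?J" "n \<in> N" for j n
    using jacobson_annihilates_minimal_ideal[OF assms(2) N _ that] min by metis+
  have "square_zero_minimal_ideal N R"
  proof (intro square_zero_minimal_ideal.intro square_zero_minimal_ideal_axioms.intro)
    fix r s x assume rsx: "r \<in> carrier R" "s \<in> carrier R" "x \<in> N"
    \<comment> \<open>The commutator lies in \<open>J\<close> because \<open>R/J\<close> is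
      commutative, and \<open>J\<close> kills \<open>N\<close> on both sides.\<close>
    let ?c = "r \<otimes>\<^bsub>R\<^esub> s \<ominus>\<^bsub>R\<^esub> s \<otimes>\<^bsub>R\<^esub> r"
    have c: "?c \<in> ?J"
      using commutator_mem_of_Quot_commutative[OF J assms(4)] rsx by blast
    have split: "r \<otimes>\<^bsub>R\<^esub> s = ?c \<oplus>\<^bsub>R\<^esub> s \<otimes>\<^bsub>R\<^esub> r"
      using rsx by (simp add: minus_eq a_assoc l_neg)
    have x: "x \<in> carrier R" "?c \<in> carrier R" using rsx N.Icarr by auto
    have "(r \<otimes>\<^bsub>R\<^esub> s) \<otimes>\<^bsub>R\<^esub> x = (?c \<oplus>\<^bsub>R\<^esub> s \<otimes>\<^bsub>R\<^esub> r) \<otimes>\<^bsub>R\<^esub> x"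
      using split by (rule arg_cong)
    then show "(r \<otimes>\<^bsub>R\<^esub> s) \<otimes>\<^bsub>R\<^esub> x = (s \<otimes>\<^bsub>R\<^esub> r) \<otimes>\<^bsub>R\<^esub> x"
      using annihil(1)[OF c rsx(3)] rsx x by (simp add: l_distr)
    have "x \<otimes>\<^bsub>R\<^esub> (r \<otimes>\<^bsub>R\<^esub> s) = x \<otimes>\<^bsub>R\<^esub> (?c \<oplus>\<^bsub>R\<^esub> s \<otimes>\<^bsub>R\<^esub> r)"
      using split by (rule arg_cong)
    then show "x \<otimes>\<^bsub>R\<^esub> (r \<otimes>\<^bsub>R\<^esub> s) = x \<otimes>\<^bsub>R\<^esub> (s \<otimes>\<^bsub>R\<^esub> r)"
      using annihil(2)[OF c rsx(3)] rsx x by (simp add: r_distr)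
  next
    fix x y assume "x \<in> N" "y \<in> N"
    then show "x \<otimes>\<^bsub>R\<^esub> y = \<zero>\<^bsub>R\<^esub>"
      using annihil(1) N(2) by blast
  qed (fact assms(1) assms(2) N min)+
  then interpret square_zero_minimal_ideal N R .
  obtain p :: nat and d where pd: "normalization_semidom_class.prime p" "\<And>r. r \<in> carrier R \<Longrightarrow> [p] \<cdot>\<^bsub>R\<^esub> r = \<zero>\<^bsub>R\<^esub>"
    "d > 0" "sigma R = enat (p ^ d + 1)"
    using sigma_elementary_prime_characteristic[OF assms(3)] by blast
  \<comment> \<open>The zero ring has no room for the nonzero ideal \<open>N\<close>.\<close>
  have "\<one>\<^bsub>R\<^esub> \<noteq> \<zero>\<^bsub>R\<^esub>"
  proof
    assume "\<one>\<^bsub>R\<^esub> = \<zero>\<^bsub>R\<^esub>"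
    then have "carrier R = {\<zero>\<^bsub>R\<^esub>}" by (simp add: one_zeroD)
    then show False
      using N(3) N.a_subset N.zero_closed by blast
  qed
  then have "characteristic R = p"
    using characteristic_eq_prime pd(1,2) by blast
  then show ?thesis
    using pd by auto
qed

end
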